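(* Let $X$ be an almost discretely Lindelöf $T_3$ topological space, i.e. a $T_3$ space such that every discrete subspace $D \subset X$ is included in a Lindelöf subspace of $X$. Then $|X| \le 2^{\chi(X)}$.
   Context: All spaces are assumed to be $T_1$ (so $T_3$ means regular and $T_1$). A subset $D \subset X$ is discrete if its subspace topology is discrete (it is not required to be closed). A space $X$ is called almost discretely Lindelöf if for every discrete set $D \subset X$ there is a subspace $Y \subset X$ with $D \subset Y$ such that $Y$, with the subspace topology, is Lindelöf (every open cover has a countable subcover). $\chi(X)$ denotes the character of $X$: the smallest infinite cardinal $\kappa$ such that every point of $X$ has a neighborhood base of size at most $\kappa$ (cardinal functions take infinite values by convention). *)

theory Defs
  imports "HOL-Analysis.Analysis"
begin

unbundle cardinal_syntax

text \<open>Discrete sets need not be closed.\<close>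

definition discrete_in :: "'a topology \<Rightarrow> 'a set \<Rightarrow> bool" where
  "discrete_in X D \<longleftrightarrow> D \<subseteq> topspace X \<and> subtopology X D = discrete_topology D"

definition almost_discretely_Lindelof :: "'a topology \<Rightarrow> bool" where
  "almost_discretely_Lindelof X \<longleftrightarrow>
     (\<forall>D. discrete_in X D \<longrightarrow>
        (\<exists>Y. D \<subseteq> Y \<and> Y \<subseteq> topspace X \<and> Lindelof_space (subtopology X Y)))"

definition T3_space :: "'a topology \<Rightarrow> bool" where
  "T3_space X \<longleftrightarrow> regular_space X \<and> t1_space X"

text \<open>The library's \<^const>\<open>neighbourhood_base_at\<close> does not require every member of
  the family to be a neighbourhood of the point; the first conjunct adds this.\<close>

definition nbhd_base_at :: "'a topology \<Rightarrow> 'a \<Rightarrow> 'a set set \<Rightarrow> bool" where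
  "nbhd_base_at X x \<B> \<longleftrightarrow>
     (\<forall>V\<in>\<B>. V \<subseteq> topspace X \<and> x \<in> X interior_of V) \<and>
     neighbourhood_base_at x (\<lambda>V. V \<in> \<B>) X"

definition char_bound :: "'a topology \<Rightarrow> 'k rel \<Rightarrow> bool" where
  "char_bound X \<kappa> \<longleftrightarrow> Cinfinite \<kappa> \<and> (\<forall>x\<in>topspace X. \<exists>\<B>. nbhd_base_at X x \<B> \<and> |\<B>| \<le>o \<kappa>)"

text \<open>The least infinite cardinal bounding the local bases, unique up to \<open>=o\<close>. A cardinal
  needs a carrier type: \<open>'a set + nat\<close> is infinite and large enough for every
  neighbourhood base, so that minimality extends to cardinals over all types
  (lemma \<open>character_least\<close>).\<close>

definition character :: "'a topology \<Rightarrow> ('a set + nat) rel" where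
  "character X = (SOME \<kappa>. char_bound X \<kappa> \<and>
     (\<forall>\<mu> :: ('a set + nat) rel. char_bound X \<mu> \<longrightarrow> \<kappa> \<le>o \<mu>))"

lemma nbhd_base_at_all_nbhds:
  "nbhd_base_at X x {V. V \<subseteq> topspace X \<and> x \<in> X interior_of V}"
  unfolding nbhd_base_at_def neighbourhood_base_at_def
  by (metis (mono_tags, lifting) interior_of_openin mem_Collect_eq openin_subset order_refl)

lemma char_bound_UNIV: "char_bound X |UNIV :: ('a set + nat) set|" for X :: "'a topology"
proof -
  have "Cinfinite |UNIV :: ('a set + nat) set|"
    unfolding BNF_Cardinal_Arithmetic.cinfinite_def Field_card_of
    by (rule conjI[OF _ card_of_card_order_on]) simp
  moreover have "|B| \<le>o |UNIV :: ('a set + nat) set|" for B :: "'a set set"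
    by (rule card_of_ordLeqI[where f = Inl]) auto
  ultimately show ?thesis
    unfolding char_bound_def by (metis nbhd_base_at_all_nbhds)
qed

lemma character_props:
  fixes X :: "'a topology"
  shows "char_bound X (character X) \<and>
    (\<forall>\<mu> :: ('a set + nat) rel. char_bound X \<mu> \<longrightarrow> character X \<le>o \<mu>)"
proof -
  let ?R = "{\<mu> :: ('a set + nat) rel. char_bound X \<mu>}"
  have "\<exists>\<kappa>\<in>?R. \<forall>\<mu>\<in>?R. \<kappa> \<le>o \<mu>"
    by (rule exists_minim_Card_order) (use char_bound_UNIV in \<open>auto simp: char_bound_def\<close>)
  then have "\<exists>\<kappa> :: ('a set + nat) rel. char_bound X \<kappa> \<and> (\<forall>\<mu> :: ('a set + nat) rel. char_bound X \<mu> \<longrightarrow> \<kappa> \<le>o \<mu>)"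
    by blast
  then show ?thesis unfolding character_def by (rule someI_ex)
qed

lemma char_bound_character: "char_bound X (character X)"
  using character_props by blast

lemma character_least:
  fixes X :: "'a topology" and \<mu> :: "'k rel"
  assumes "char_bound X \<mu>"
  shows "character X \<le>o \<mu>"
proof (cases "|UNIV :: ('a set + nat) set| \<le>o \<mu>")
  case True
  have "character X \<le>o |UNIV :: ('a set + nat) set|"
    using character_props[of X] char_bound_UNIV[of X] by blast
  then show ?thesis using True by (rule ordLeq_transitive)
next
  case False
  have co: "Card_order \<mu>" and inf: "\<not> finite (Field \<mu>)"
    using assms by (simp_all add: char_bound_def BNF_Cardinal_Arithmetic.cinfinite_def)
  have "\<mu> \<le>o |UNIV :: ('a set + nat) set|"
    using False ordLeq_total[OF card_order_on_well_order_on[OF co] card_of_Well_order] by blast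
  then have "|Field \<mu>| \<le>o |UNIV :: ('a set + nat) set|"
    by (rule ordIso_ordLeq_trans[OF card_of_Field_ordIso[OF co]])
  then obtain f :: "'k \<Rightarrow> 'a set + nat" where f: "inj_on f (Field \<mu>)"
    unfolding card_of_ordLeq[symmetric] by blast
  let ?\<nu> = "|f ` Field \<mu>|"
  have "|Field \<mu>| =o ?\<nu>"
    by (rule card_of_ordIsoI[OF inj_on_imp_bij_betw[OF f]])
  then have iso: "\<mu> =o ?\<nu>"
    by (rule ordIso_transitive[OF ordIso_symmetric[OF card_of_Field_ordIso[OF co]]])
  have "Cinfinite ?\<nu>"
    by (rule conjI[OF _ card_of_Card_order])
      (simp add: BNF_Cardinal_Arithmetic.cinfinite_def Field_card_of finite_image_iff[OF f] inf)
  moreover have "\<exists>\<B>. nbhd_base_at X x \<B> \<and> |\<B>| \<le>o ?\<nu>" if x: "x \<in> topspace X" for x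
  proof -
    obtain \<B> where "nbhd_base_at X x \<B>" "|\<B>| \<le>o \<mu>"
      using assms x unfolding char_bound_def by blast
    then show ?thesis using ordLeq_ordIso_trans[OF _ iso] by blast
  qed
  ultimately have "char_bound X ?\<nu>"
    unfolding char_bound_def by blast
  then have "character X \<le>o ?\<nu>"
    using character_props[of X] by blast
  then show ?thesis by (rule ordLeq_ordIso_trans[OF _ ordIso_symmetric[OF iso]])
qed

end

theory Submission
  imports Defs
begin

text \<open>Put \<open>\<kappa> = \<chi>(X)\<close> and \<open>\<mu> = 2\<^sup>\<kappa>\<close>; then \<open>|cl A| \<le> \<mu>\<close> whenever \<open>|A| \<le> \<mu>\<close>. Suppose that the closure of
  every set of size at most \<open>\<kappa>\<close> is the intersection of at most \<open>\<mu>\<close> of its open neighbourhoods. A tree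
  of height \<open>\<kappa>\<^sup>+\<close> that branches over these neighbourhoods has at most \<open>\<mu>\<close> nodes. A point outside the
  closures attached to the nodes would yield a free sequence of length \<open>\<kappa>\<^sup>+\<close>, which is discrete, so it
  lies in a Lindelof subspace; with tightness at most \<open>\<kappa>\<close> this is impossible. Hence \<open>|X| \<le> \<mu>\<close>.

  The supposition holds for Lindelof Hausdorff spaces, by countable unions of basic open sets, so
  Lindelof subspaces, and with them all discrete subspaces of \<open>X\<close>, have size at most \<open>\<mu>\<close>.
  By Shapirovskii's lemma every family of open sets of \<open>X\<close> then has a subfamily of size at most \<open>\<mu>\<close>
  with the same union. Applied to the open sets whose closure misses a closed set \<open>K\<close>, this gives,
  by regularity, the supposition for \<open>X\<close> itself.\<close>

section \<open>Cardinal bounds\<close>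

lemma Cinfinite_ctwo_cexp: "Cinfinite \<kappa> \<Longrightarrow> Cinfinite (ctwo ^c \<kappa>)"
  by (rule Cinfinite_cexp) (simp_all add: ordLeq_refl Card_order_ctwo)

lemma ordLeq_ctwo_cexp: "Cinfinite \<kappa> \<Longrightarrow> A \<le>o \<kappa> \<Longrightarrow> A \<le>o ctwo ^c \<kappa>"
  by (meson ordLess_ctwo_cexp ordLess_imp_ordLeq ordLeq_transitive)

lemma countable_ordLeq:
  assumes "countable A" "Cinfinite \<kappa>"
  shows "|A| \<le>o \<kappa>"
proof -
  obtain f :: "_ \<Rightarrow> nat" where "inj_on f A"
    using assms(1) unfolding countable_def by blast
  then have "|A| \<le>o |UNIV :: nat set|"
    unfolding card_of_ordLeq[symmetric] by blast
  also have "|UNIV :: nat set| =o natLeq" by (rule card_of_nat)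
  also have "natLeq \<le>o \<kappa>" by (rule natLeq_ordLeq_cinfinite[OF assms(2)])
  finally show ?thesis .
qed

text \<open>The bound reduces to
  \<open>(2\<^sup>\<kappa>)\<^sup>\<kappa> = 2\<^sup>\<kappa>\<close>. Empty \<open>A\<close> is
  treated apart because enlarging the exponent 0 can lower a power of base 0, as
  \<open>0\<^sup>0 = 1\<close>.\<close>

lemma card_of_Func_ordLeq:
  assumes "Cinfinite \<kappa>" "|A| \<le>o \<kappa>" "|B| \<le>o ctwo ^c \<kappa>"
  shows "|Func A B| \<le>o ctwo ^c \<kappa>"
proof (cases "A = {}")
  case True
  then show ?thesis
    by (simp add: Func_empty countable_ordLeq[OF _ Cinfinite_ctwo_cexp[OF assms(1)]])
next
  case False
  have "|Func A B| = |B| ^c |A|" by (simp add: cexp_def Field_card_of)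
  also have "|B| ^c |A| \<le>o (ctwo ^c \<kappa>) ^c \<kappa>"
    by (rule cexp_mono'[OF assms(3,2)]) (use False in \<open>simp add: Field_card_of\<close>)
  also have "(ctwo ^c \<kappa>) ^c \<kappa> =o ctwo ^c \<kappa>"
    using assms(1) by (intro cexp_cprod_ordLeq Cinfinite_Cnotzero ordLeq_refl Card_order_ctwo) auto
  finally show ?thesis .
qed

lemma card_of_UN_ordLeq:
  assumes "Cinfinite r" "|I| \<le>o r" "\<And>i. i \<in> I \<Longrightarrow> |A i| \<le>o r"
  shows "|\<Union>i\<in>I. A i| \<le>o r"
  using assms card_of_UNION_ordLeq_infinite_Field[of r I A] by (auto simp: BNF_Cardinal_Arithmetic.cinfinite_def)

lemma card_of_image_ordLeq: "|A| \<le>o r \<Longrightarrow> |f ` A| \<le>o r"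
  by (rule ordLeq_transitive[OF card_of_image])

lemma card_of_subset_ordLeq: "A \<subseteq> B \<Longrightarrow> |B| \<le>o r \<Longrightarrow> |A| \<le>o r"
  by (rule ordLeq_transitive[OF card_of_mono1])

lemma card_of_Field_ordLeq: "Card_order r \<Longrightarrow> |Field r| \<le>o r"
  by (rule ordIso_imp_ordLeq[OF card_of_Field_ordIso])

lemma card_of_insert_ordLeq:
  assumes "Cinfinite r" "|A| \<le>o r"
  shows "|insert a A| \<le>o r"
proof -
  have "|{a} \<union> A| \<le>o r"
    using assms countable_ordLeq[of "{a}" r]
    by (intro card_of_Un_ordLeq_infinite_Field) (auto simp: BNF_Cardinal_Arithmetic.cinfinite_def)
  then show ?thesis by simp
qed

section \<open>Spaces of bounded character\<close>

text \<open>The single index set \<open>Field \<kappa>\<close> serves all points, so that points of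
  a closure can be coded by functions on pairs of indices. Repetitions are allowed, which
  accommodates smaller local bases.\<close>

definition indexed_base :: "'a topology \<Rightarrow> 'k rel \<Rightarrow> ('a \<Rightarrow> 'k \<Rightarrow> 'a set) \<Rightarrow> bool" where
  "indexed_base X \<kappa> V \<longleftrightarrow> (\<forall>x\<in>topspace X.
     (\<forall>i\<in>Field \<kappa>. openin X (V x i) \<and> x \<in> V x i) \<and>
     (\<forall>U. openin X U \<and> x \<in> U \<longrightarrow> (\<exists>i\<in>Field \<kappa>. V x i \<subseteq> U)))"

text \<open>A local base is nonempty, hence an image of \<open>Field \<kappa>\<close>; passing to
  interiors makes its members open.\<close>

lemma char_bound_imp_indexed_base:
  assumes "char_bound X \<kappa>"
  obtains V where "indexed_base X \<kappa> V"
proof -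
  have "\<exists>W. (\<forall>i\<in>Field \<kappa>. openin X (W i) \<and> x \<in> W i) \<and>
      (\<forall>U. openin X U \<and> x \<in> U \<longrightarrow> (\<exists>i\<in>Field \<kappa>. W i \<subseteq> U))" if x: "x \<in> topspace X" for x
  proof -
    obtain \<B> where \<B>: "nbhd_base_at X x \<B>" "|\<B>| \<le>o \<kappa>" and \<kappa>: "Card_order \<kappa>"
      using assms x unfolding char_bound_def by blast
    have ne: "\<B> \<noteq> {}"
      using \<B>(1) x unfolding nbhd_base_at_def neighbourhood_base_at_def by blast
    have "|\<B>| \<le>o |Field \<kappa>|"
      by (rule ordLeq_ordIso_trans[OF \<B>(2) ordIso_symmetric[OF card_of_Field_ordIso[OF \<kappa>]]])
    then obtain g where g: "g ` Field \<kappa> = \<B>"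
      using card_of_ordLeq2[OF ne, THEN iffD2] by blast
    show ?thesis
    proof (rule exI[of _ "\<lambda>i. X interior_of g i"], intro conjI ballI allI impI)
      fix i assume "i \<in> Field \<kappa>"
      then show "x \<in> X interior_of g i"
        using g \<B>(1) unfolding nbhd_base_at_def by blast
    next
      fix U assume "openin X U \<and> x \<in> U"
      then obtain B where "B \<in> \<B>" "B \<subseteq> U"
        using \<B>(1) unfolding nbhd_base_at_def neighbourhood_base_at_def by blast
      then show "\<exists>i\<in>Field \<kappa>. X interior_of g i \<subseteq> U"
        using g interior_of_subset[of X] by blast
    qed auto
  qed
  then have "\<exists>V. \<forall>x\<in>topspace X. (\<forall>i\<in>Field \<kappa>. openin X (V x i) \<and> x \<in> V x i) \<and>
      (\<forall>U. openin X U \<and> x \<in> U \<longrightarrow> (\<exists>i\<in>Field \<kappa>. V x i \<subseteq> U))"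
    by (intro bchoice ballI)
  then show ?thesis using that unfolding indexed_base_def by blast
qed

text \<open>Lets the bound for Lindelof Hausdorff spaces be applied to the Lindelof subspaces that
  contain discrete sets.\<close>

lemma indexed_base_subtopology:
  assumes "indexed_base X \<kappa> V"
  shows "indexed_base (subtopology X S) \<kappa> (\<lambda>x i. S \<inter> V x i)"
  unfolding indexed_base_def
proof (intro ballI conjI allI impI)
  fix x i assume "x \<in> topspace (subtopology X S)" "i \<in> Field \<kappa>"
  then show "openin (subtopology X S) (S \<inter> V x i)" "x \<in> S \<inter> V x i"
    using assms unfolding indexed_base_def by (auto intro: openin_subtopology_Int2)
next
  fix x U assume x: "x \<in> topspace (subtopology X S)" and "openin (subtopology X S) U \<and> x \<in> U"
  then obtain T where T: "openin X T" "U = T \<inter> S" "x \<in> T"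
    unfolding openin_subtopology by blast
  then obtain i where "i \<in> Field \<kappa>" "V x i \<subseteq> T"
    using assms x unfolding indexed_base_def topspace_subtopology by blast
  then show "\<exists>i\<in>Field \<kappa>. S \<inter> V x i \<subseteq> U" using T(2) by blast
qed

text \<open>One point of \<open>A\<close> from each of the at most \<kappa> basic neighbourhoods of
  \<open>p\<close> suffices.\<close>

lemma closure_of_tight:
  assumes V: "indexed_base X \<kappa> V" and "Card_order \<kappa>" and p: "p \<in> X closure_of A"
  obtains B where "B \<subseteq> A" "|B| \<le>o \<kappa>" "p \<in> X closure_of B"
proof -
  have pX: "p \<in> topspace X" using p by (simp add: in_closure_of)
  have "\<forall>i\<in>Field \<kappa>. \<exists>a. a \<in> A \<and> a \<in> V p i"
    using V p pX unfolding indexed_base_def in_closure_of by blast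
  then obtain a where a: "\<And>i. i \<in> Field \<kappa> \<Longrightarrow> a i \<in> A \<and> a i \<in> V p i"
    by metis
  show ?thesis
  proof
    show "a ` Field \<kappa> \<subseteq> A" using a by blast
    show "|a ` Field \<kappa>| \<le>o \<kappa>"
      by (rule card_of_image_ordLeq[OF card_of_Field_ordLeq[OF assms(2)]])
    show "p \<in> X closure_of (a ` Field \<kappa>)"
      unfolding in_closure_of
    proof (intro conjI allI impI pX)
      fix U assume "p \<in> U \<and> openin X U"
      then obtain i where "i \<in> Field \<kappa>" "V p i \<subseteq> U"
        using V pX unfolding indexed_base_def by blast
      then show "\<exists>y. y \<in> a ` Field \<kappa> \<and> y \<in> U" using a by blast
    qed
  qed
qed

text \<open>A point \<open>p\<close> of the closure is coded by any \<open>g\<close> with \<open>g (i, j) \<in> V p i \<inter> V p j \<inter> A\<close>: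
  if \<open>g\<close> also coded \<open>q\<close>, then \<open>V p i\<close> would meet \<open>V q j\<close> for all \<open>i\<close> and \<open>j\<close>.\<close>

lemma card_of_closure_of_ordLeq:
  assumes V: "indexed_base X \<kappa> V" and \<kappa>: "Cinfinite \<kappa>" and H: "Hausdorff_space X"
    and A: "|A| \<le>o ctwo ^c \<kappa>"
  shows "|X closure_of A| \<le>o ctwo ^c \<kappa>"
proof -
  let ?I = "Field \<kappa> \<times> Field \<kappa>"
  have "\<forall>p\<in>X closure_of A. \<exists>g. g \<in> Func ?I A \<and> (\<forall>i\<in>Field \<kappa>. \<forall>j\<in>Field \<kappa>. g (i, j) \<in> V p i \<inter> V p j)"
  proof
    fix p assume p: "p \<in> X closure_of A"
    then have pX: "p \<in> topspace X" by (simp add: in_closure_of)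
    have "\<exists>a. a \<in> A \<and> a \<in> V p i \<inter> V p j" if "i \<in> Field \<kappa>" "j \<in> Field \<kappa>" for i j
    proof -
      have "openin X (V p i \<inter> V p j)" "p \<in> V p i \<inter> V p j"
        using V pX that unfolding indexed_base_def by (blast intro: openin_Int)+
      then show ?thesis using p unfolding in_closure_of by blast
    qed
    then obtain a where a: "\<And>i j. i \<in> Field \<kappa> \<Longrightarrow> j \<in> Field \<kappa> \<Longrightarrow> a i j \<in> A \<and> a i j \<in> V p i \<inter> V p j"
      by metis
    show "\<exists>g. g \<in> Func ?I A \<and> (\<forall>i\<in>Field \<kappa>. \<forall>j\<in>Field \<kappa>. g (i, j) \<in> V p i \<inter> V p j)"
      by (rule exI[of _ "\<lambda>x. if x \<in> ?I then a (fst x) (snd x) else undefined"])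
        (use a in \<open>auto simp: Func_def\<close>)
  qed
  then obtain g where g: "\<And>p. p \<in> X closure_of A \<Longrightarrow> g p \<in> Func ?I A"
      "\<And>p i j. p \<in> X closure_of A \<Longrightarrow> i \<in> Field \<kappa> \<Longrightarrow> j \<in> Field \<kappa> \<Longrightarrow> g p (i, j) \<in> V p i \<inter> V p j"
    by metis
  have "inj_on g (X closure_of A)"
  proof (rule inj_onI, rule ccontr)
    fix p q assume pq: "p \<in> X closure_of A" "q \<in> X closure_of A" "g p = g q" "p \<noteq> q"
    then have X: "p \<in> topspace X" "q \<in> topspace X" by (simp_all add: in_closure_of)
    then obtain S T where "openin X S" "openin X T" "p \<in> S" "q \<in> T" "disjnt S T"
      using H pq(4) unfolding Hausdorff_space_def by blast
    moreover then obtain i j where "i \<in> Field \<kappa>" "V p i \<subseteq> S" "j \<in> Field \<kappa>" "V q j \<subseteq> T"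
      using V X unfolding indexed_base_def by meson
    ultimately show False
      using g(2)[OF pq(1), of i j] g(2)[OF pq(2), of i j] pq(3) by (auto simp: disjnt_iff)
  qed
  then have "|X closure_of A| \<le>o |Func ?I A|"
    unfolding card_of_ordLeq[symmetric] using g(1) by blast
  also have "|Func ?I A| \<le>o ctwo ^c \<kappa>"
    using \<kappa> card_of_Field_ordLeq[of \<kappa>]
    by (intro card_of_Func_ordLeq card_of_Times_ordLeq_infinite_Field A)
      (auto simp: BNF_Cardinal_Arithmetic.cinfinite_def)
  finally show ?thesis .
qed

section \<open>Discrete subspaces\<close>

lemma discrete_inI:
  assumes "D \<subseteq> topspace X" "\<And>d. d \<in> D \<Longrightarrow> \<exists>U. openin X U \<and> U \<inter> D = {d}"
  shows "discrete_in X D"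
proof -
  have "topspace (subtopology X D) = D" using assms(1) by auto
  moreover have "openin (subtopology X D) {d}" if "d \<in> D" for d
    using assms(2)[OF that] by (metis openin_subtopology)
  ultimately show ?thesis
    using assms(1) unfolding discrete_in_def
    by (metis discrete_topology_unique)
qed

text \<open>Shapirovskii's lemma. Along a well-ordering of \<open>\<Union>\<V>\<close>, the set \<open>D\<close> collects the points that
  are not yet covered when they are reached.\<close>

lemma Shapirovskii:
  assumes \<V>: "\<And>U. U \<in> \<V> \<Longrightarrow> openin X U" and W: "\<And>x. x \<in> \<Union>\<V> \<Longrightarrow> W x \<in> \<V> \<and> x \<in> W x"
  obtains D where "discrete_in X D" "D \<subseteq> \<Union>\<V>" "\<Union>\<V> \<subseteq> X closure_of D \<union> (\<Union>d\<in>D. W d)"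
proof -
  obtain r :: "'a rel" where r: "well_order_on UNIV r" using well_order_on by blast
  have wf: "wf (r - Id)" and lin: "linear_order_on UNIV r"
    using r by (simp_all add: well_order_on_def)
  have tot: "(x, y) \<in> r - Id \<or> x = y \<or> (y, x) \<in> r - Id" for x y
    using lin unfolding linear_order_on_def total_on_def by blast
  define H where "H P x \<longleftrightarrow> x \<in> \<Union>\<V> \<and>
    x \<notin> X closure_of {d. (d, x) \<in> r - Id \<and> P d} \<union> (\<Union>d\<in>{d. (d, x) \<in> r - Id \<and> P d}. W d)"
    for P x
  define P where "P = wfrec (r - Id) H"
  have P: "P x \<longleftrightarrow> H P x" for x
  proof -
    \<comment> \<open>\<open>H\<close> consults its first argument only at predecessors of
      \<open>x\<close>, where \<open>cut\<close> changes nothing.\<close>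
    have "P x \<longleftrightarrow> H (cut P (r - Id) x) x"
      unfolding P_def by (subst wfrec[OF wf]) simp
    moreover have "{d. (d, x) \<in> r - Id \<and> cut P (r - Id) x d} = {d. (d, x) \<in> r - Id \<and> P d}"
      by (auto simp: cut_def)
    ultimately show ?thesis unfolding H_def by presburger
  qed
  let ?D = "Collect P"
  let ?B = "\<lambda>x. {d. (d, x) \<in> r - Id \<and> P d}"
  have D: "?D \<subseteq> \<Union>\<V>" using P by (auto simp: H_def)
  show ?thesis
  proof
    show "?D \<subseteq> \<Union>\<V>" by (fact D)
    show "\<Union>\<V> \<subseteq> X closure_of ?D \<union> (\<Union>d\<in>?D. W d)"
    proof
      fix x assume x: "x \<in> \<Union>\<V>"
      show "x \<in> X closure_of ?D \<union> (\<Union>d\<in>?D. W d)"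
      proof (cases "P x")
        case True
        then show ?thesis using W[OF x] by (intro UnI2 UN_I[of x]) auto
      next
        case False
        then consider "x \<in> X closure_of ?B x" | "x \<in> (\<Union>d\<in>?B x. W d)"
          using P[of x] x unfolding H_def by blast
        then show ?thesis
        proof cases
          case 1
          moreover have "?B x \<subseteq> ?D" by blast
          ultimately show ?thesis using closure_of_mono by blast
        next
          case 2
          then show ?thesis by blast
        qed
      qed
    qed
    show "discrete_in X ?D"
    proof (rule discrete_inI)
      show "?D \<subseteq> topspace X" using D \<V> openin_subset by blast
      fix d assume "d \<in> ?D"
      then have d: "P d" by simp
      then have dV: "d \<in> \<Union>\<V>" using D by blast
      \<comment> \<open>The closure removes all earlier points of \<open>?D\<close>, and
        \<open>W d\<close> contains no later one, since later points are chosen outside it.\<close>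
      let ?U = "W d - X closure_of ?B d"
      have "openin X ?U" using W[OF dV] \<V> by (blast intro: openin_diff closedin_closure_of)
      moreover have "d \<in> ?U" using d W[OF dV] P[of d] by (auto simp: H_def)
      moreover have "e = d" if e: "P e" "e \<in> ?U" for e
      proof (rule ccontr)
        assume "e \<noteq> d"
        then consider "(e, d) \<in> r - Id" | "(d, e) \<in> r - Id" using tot by blast
        then show False
        proof cases
          case 1
          then have "e \<in> ?B d" using e by blast
          moreover have "e \<in> topspace X" using e dV W[OF dV] \<V> openin_subset by blast
          ultimately have "e \<in> X closure_of ?B d" unfolding in_closure_of by blast
          then show False using e by blast
        next
          case 2
          then have "e \<notin> W d" using e d P[of e] by (auto simp: H_def)
          then show False using e by blast
        qed
      qed
      ultimately show "\<exists>U. openin X U \<and> U \<inter> ?D = {d}" using d by (intro exI[of _ ?U]) blast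
    qed
  qed
qed

section \<open>Bounding the cardinality through free sequences\<close>

text \<open>Separation axioms are replaced by \<open>cl\<close> and \<open>psi\<close> because the
  argument is used twice, with different proofs of \<open>psi\<close>. The bound is a count:
  \<open>\<kappa>\<^sup>+\<close> levels, at most \<open>(2\<^sup>\<kappa>)\<^sup>\<kappa>\<close>
  nodes on each, and at most \<open>2\<^sup>\<kappa>\<close> points in the closure at each
  node.\<close>

lemma card_le_of_closure_pseudocharacter:
  fixes X :: "'a topology" and \<kappa> :: "'k rel"
  assumes \<kappa>: "Cinfinite \<kappa>"
    and tight: "\<And>A p. p \<in> X closure_of A \<Longrightarrow> \<exists>B\<subseteq>A. |B| \<le>o \<kappa> \<and> p \<in> X closure_of B"
    and adl: "almost_discretely_Lindelof X"
    and cl: "\<And>A. A \<subseteq> topspace X \<Longrightarrow> |A| \<le>o \<kappa> \<Longrightarrow> |X closure_of A| \<le>o ctwo ^c \<kappa>"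
    and psi: "\<And>A. A \<subseteq> topspace X \<Longrightarrow> |A| \<le>o \<kappa> \<Longrightarrow>
      \<exists>\<O>. |\<O>| \<le>o ctwo ^c \<kappa> \<and> (\<forall>U\<in>\<O>. openin X U \<and> X closure_of A \<subseteq> U) \<and>
        (\<forall>p\<in>topspace X - X closure_of A. \<exists>U\<in>\<O>. p \<notin> U)"
  shows "|topspace X| \<le>o ctwo ^c \<kappa>"
proof (cases "topspace X = {}")
  case True
  then show ?thesis by (simp add: countable_ordLeq[OF _ Cinfinite_ctwo_cexp[OF \<kappa>]])
next
  case False
  then obtain p0 where p0: "p0 \<in> topspace X" by blast

  \<comment> \<open>The successor cardinal and its initial segments\<close>
  define r where "r = cardSuc \<kappa>"
  define T where "T = Field (ctwo ^c \<kappa>)"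
  have co: "Card_order \<kappa>" and inf: "\<not> finite (Field \<kappa>)"
    using \<kappa> by (simp_all add: BNF_Cardinal_Arithmetic.cinfinite_def)
  have \<mu>: "Cinfinite (ctwo ^c \<kappa>)" by (rule Cinfinite_ctwo_cexp[OF \<kappa>])
  have cor: "Card_order r" unfolding r_def by (rule cardSuc_Card_order[OF co])
  have wo: "Well_order r" by (rule card_order_on_well_order_on[OF cor])
  then have lin: "Linear_order r" and wf: "wf (r - Id)" by (simp_all add: well_order_on_def)
  have tr: "trans r" and an: "antisym r" and tot: "Total r" and rfl: "\<And>\<alpha>. \<alpha> \<in> Field r \<Longrightarrow> (\<alpha>, \<alpha>) \<in> r"
    using lin by (auto simp: order_on_defs refl_on_def)
  have cmp: "(\<alpha>, \<beta>) \<in> r \<or> (\<beta>, \<alpha>) \<in> r" if "\<alpha> \<in> Field r" "\<beta> \<in> Field r" for \<alpha> \<beta>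
    using tot rfl that unfolding total_on_def by metis
  have sub: "\<gamma> \<in> underS r \<alpha>" if "(\<beta>, \<alpha>) \<in> r" "\<gamma> \<in> underS r \<beta>" for \<alpha> \<beta> \<gamma>
    using that tr an unfolding underS_def trans_def antisym_def by blast
  have inr: "\<not> finite (Field r)" unfolding r_def using cardSuc_finite[OF co] inf by simp
  have nomax: "\<exists>\<beta>\<in>Field r. \<alpha> \<in> underS r \<beta>" if "\<alpha> \<in> Field r" for \<alpha>
    using infinite_Card_order_limit[OF cor inr that] unfolding underS_def by blast
  have card_underS: "|underS r \<alpha>| \<le>o \<kappa>" if "\<alpha> \<in> Field r" for \<alpha>
    using card_of_underS[OF cor that] unfolding r_def
    using cardSuc_ordLeq_ordLess[OF co card_of_Card_order] by blast
  have chain: "relChain r (underS r)" unfolding relChain_def using sub by blast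
  \<comment> \<open>Regularity of \<open>\<kappa>\<^sup>+\<close>, applied to the increasing chain
    of its initial segments; these exhaust \<open>Field r\<close> because there is no largest
    element.\<close>
  have bounded: "\<exists>\<alpha>\<in>Field r. I \<subseteq> underS r \<alpha>" if "I \<subseteq> Field r" "|I| \<le>o \<kappa>" for I
    unfolding r_def
    by (rule cardSuc_UNION[OF co inf chain[unfolded r_def] _ that(2)])
      (use that(1) nomax in \<open>unfold r_def, blast\<close>)

  \<comment> \<open>Neighbourhoods of small closures, labelled by \<open>T\<close>\<close>
  have "Field (ctwo ^c \<kappa>) \<noteq> {}"
    using \<mu> by (auto simp: BNF_Cardinal_Arithmetic.cinfinite_def)
  then obtain t0 where t0: "t0 \<in> T" unfolding T_def by blast
  have "\<exists>G. (\<forall>t\<in>T. openin X (G t) \<and> X closure_of A \<subseteq> G t) \<and>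
      (\<forall>p\<in>topspace X - X closure_of A. \<exists>t\<in>T. p \<notin> G t)"
    if A: "A \<subseteq> topspace X" "|A| \<le>o \<kappa>" for A
  proof -
    obtain \<O> where \<O>: "|\<O>| \<le>o ctwo ^c \<kappa>" "\<forall>U\<in>\<O>. openin X U \<and> X closure_of A \<subseteq> U"
        "\<forall>p\<in>topspace X - X closure_of A. \<exists>U\<in>\<O>. p \<notin> U"
      using psi[OF A] by blast
    \<comment> \<open>Adding the whole space makes the family nonempty, so that \<open>T\<close>
      maps onto it.\<close>
    have "|insert (topspace X) \<O>| \<le>o |T|"
      unfolding T_def
      by (rule ordLeq_ordIso_trans[OF card_of_insert_ordLeq[OF \<mu> \<O>(1)] ordIso_symmetric[OF card_of_Field_ordIso]])
        (use \<mu> in blast)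
    then obtain G where G: "G ` T = insert (topspace X) \<O>"
      using card_of_ordLeq2[THEN iffD2, of "insert (topspace X) \<O>" T] by blast
    have "openin X U \<and> X closure_of A \<subseteq> U" if "U \<in> insert (topspace X) \<O>" for U
      using that \<O>(2) closure_of_subset_topspace[of X A] openin_topspace[of X] by blast
    then have "\<forall>t\<in>T. openin X (G t) \<and> X closure_of A \<subseteq> G t" using G by blast
    moreover have "\<exists>t\<in>T. p \<notin> G t" if p: "p \<in> topspace X - X closure_of A" for p
    proof -
      obtain U where "U \<in> \<O>" "p \<notin> U" using \<O>(3) p by blast
      moreover then obtain t where "t \<in> T" "G t = U" using G by (metis imageE insertI2)
      ultimately show ?thesis by blast
    qed
    ultimately show ?thesis by blast
  qed
  then obtain g where g: "\<And>A t. A \<subseteq> topspace X \<Longrightarrow> |A| \<le>o \<kappa> \<Longrightarrow> t \<in> T \<Longrightarrow> openin X (g A t) \<and> X closure_of A \<subseteq> g A t"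
      "\<And>A p. A \<subseteq> topspace X \<Longrightarrow> |A| \<le>o \<kappa> \<Longrightarrow> p \<in> topspace X - X closure_of A \<Longrightarrow> \<exists>t\<in>T. p \<notin> g A t"
    by metis

  \<comment> \<open>The tree and its branches\<close>
  define h where "h S = (if topspace X \<subseteq> S then p0 else SOME x. x \<in> topspace X - S)" for S
  \<comment> \<open>The default \<open>p0\<close> keeps the values inside the space even when
    \<open>S\<close> covers it.\<close>
  have h: "h S \<in> topspace X" "\<not> topspace X \<subseteq> S \<Longrightarrow> h S \<notin> S" for S
  proof -
    have *: "\<not> topspace X \<subseteq> S \<Longrightarrow> (SOME x. x \<in> topspace X - S) \<in> topspace X - S"
      by (rule someI_ex) blast
    show "h S \<in> topspace X" "\<not> topspace X \<subseteq> S \<Longrightarrow> h S \<notin> S"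
      using * p0 by (auto simp: h_def)
  qed
  \<comment> \<open>\<open>y f\<close> is the branch with labels \<open>f\<close>; \<open>y f \<alpha>\<close> depends only on \<open>f\<close> up to \<open>\<alpha>\<close>.\<close>
  define y where "y f = wfrec (r - Id) (\<lambda>Y \<alpha>. h (\<Union>\<beta>\<in>under r \<alpha>. g (Y ` underS r \<beta>) (f \<beta>)))" for f
  \<comment> \<open>The union includes \<open>\<beta> = \<alpha>\<close>: the new point must also
    avoid the neighbourhood chosen for the closure of all its predecessors.\<close>
  have y: "y f \<alpha> = h (\<Union>\<beta>\<in>under r \<alpha>. g (y f ` underS r \<beta>) (f \<beta>))" for f \<alpha>
  proof -
    have "cut (y f) (r - Id) \<alpha> ` underS r \<beta> = y f ` underS r \<beta>" if "\<beta> \<in> under r \<alpha>" for \<beta>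
    proof (rule image_cong[OF refl])
      fix \<gamma> assume "\<gamma> \<in> underS r \<beta>"
      then have "\<gamma> \<in> underS r \<alpha>" using sub that unfolding under_def by blast
      then show "cut (y f) (r - Id) \<alpha> \<gamma> = y f \<gamma>" by (simp add: cut_def underS_def)
    qed
    then have "(\<Union>\<beta>\<in>under r \<alpha>. g (cut (y f) (r - Id) \<alpha> ` underS r \<beta>) (f \<beta>)) =
        (\<Union>\<beta>\<in>under r \<alpha>. g (y f ` underS r \<beta>) (f \<beta>))"
      by simp
    moreover have "y f \<alpha> = h (\<Union>\<beta>\<in>under r \<alpha>. g (cut (y f) (r - Id) \<alpha> ` underS r \<beta>) (f \<beta>))"
      by (rule def_wfrec[OF eq_reflection[OF y_def] wf])
    ultimately show ?thesis by simp
  qed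
  have y_cong: "y f \<alpha> = y f' \<alpha>" if "\<And>\<beta>. \<beta> \<in> under r \<alpha> \<Longrightarrow> f \<beta> = f' \<beta>" for f f' \<alpha>
    using wf that
  proof (induction \<alpha> rule: wf_induct_rule)
    case (less \<alpha>)
    have "y f ` underS r \<beta> = y f' ` underS r \<beta>" if \<beta>: "\<beta> \<in> under r \<alpha>" for \<beta>
    proof (rule image_cong[OF refl])
      fix \<gamma> assume "\<gamma> \<in> underS r \<beta>"
      then have \<gamma>: "\<gamma> \<in> underS r \<alpha>" using sub \<beta> unfolding under_def by blast
      then have "(\<gamma>, \<alpha>) \<in> r - Id" by (auto simp: underS_def)
      moreover have "f \<delta> = f' \<delta>" if "\<delta> \<in> under r \<gamma>" for \<delta>
        using that \<gamma> tr less.prems unfolding under_def underS_def trans_def by blast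
      ultimately show "y f \<gamma> = y f' \<gamma>" by (rule less.IH)
    qed
    then show ?case unfolding y[of f \<alpha>] y[of f' \<alpha>] using less.prems by simp
  qed
  \<comment> \<open>The predecessors of level \<alpha> are determined by the labels strictly below
    \<alpha>, which makes the coding of nodes by \<open>Codes\<close> possible.\<close>
  have y_cong': "y f ` underS r \<alpha> = y f' ` underS r \<alpha>" if "\<And>\<beta>. \<beta> \<in> underS r \<alpha> \<Longrightarrow> f \<beta> = f' \<beta>" for f f' \<alpha>
  proof (intro image_cong[OF refl] y_cong that)
    fix \<gamma> \<beta> assume "\<gamma> \<in> underS r \<alpha>" "\<beta> \<in> under r \<gamma>"
    then show "\<beta> \<in> underS r \<alpha>"
      using tr an unfolding underS_def under_def trans_def antisym_def by blast
  qed
  have yX: "y f ` S \<subseteq> topspace X" for f S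
    using h(1) y by (metis image_subsetI)
  have yc: "|y f ` underS r \<alpha>| \<le>o \<kappa>" if "\<alpha> \<in> Field r" for f \<alpha>
    by (rule card_of_image_ordLeq[OF card_underS[OF that]])
  define Codes where "Codes = (SIGMA \<alpha>:Field r. Func (underS r \<alpha>) T)"

  \<comment> \<open>The closures at the nodes cover the space\<close>
  have "p \<in> (\<Union>(\<alpha>, f)\<in>Codes. X closure_of (y f ` underS r \<alpha>))" if p: "p \<in> topspace X" for p
  proof -
    define Q where "Q f \<alpha> s \<longleftrightarrow> s \<in> T \<and> (p \<notin> X closure_of (y f ` underS r \<alpha>) \<longrightarrow> p \<notin> g (y f ` underS r \<alpha>) s)"
      for f \<alpha> s
    \<comment> \<open>\<open>t\<close> follows \<open>p\<close>: its labels choose neighbourhoods that exclude \<open>p\<close> as long as possible.\<close>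
    define t where "t = wfrec (r - Id) (\<lambda>f \<alpha>. SOME s. Q f \<alpha> s)"
    have "t \<alpha> = (SOME s. Q t \<alpha> s)" for \<alpha>
    proof -
      have "y (cut t (r - Id) \<alpha>) ` underS r \<alpha> = y t ` underS r \<alpha>"
        by (rule y_cong') (auto simp: cut_def underS_def)
      then have "Q (cut t (r - Id) \<alpha>) \<alpha> = Q t \<alpha>" unfolding Q_def by presburger
      moreover have "t \<alpha> = (SOME s. Q (cut t (r - Id) \<alpha>) \<alpha> s)"
        by (rule def_wfrec[OF eq_reflection[OF t_def] wf])
      ultimately show ?thesis by simp
    qed
    \<comment> \<open>As long as \<open>p\<close> is outside the closure, some labelled
      neighbourhood omits it; afterwards \<open>t0\<close> serves.\<close>
    moreover have "\<exists>s. Q t \<alpha> s" if "\<alpha> \<in> Field r" for \<alpha>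
      using g(2)[OF yX yc[OF that]] p t0 unfolding Q_def by blast
    ultimately have Qt: "Q t \<alpha> (t \<alpha>)" if "\<alpha> \<in> Field r" for \<alpha>
      using that by (metis someI_ex)
    show ?thesis
    proof (cases "\<exists>\<alpha>\<in>Field r. p \<in> X closure_of (y t ` underS r \<alpha>)")
      case True
      then obtain \<alpha> where \<alpha>: "\<alpha> \<in> Field r" "p \<in> X closure_of (y t ` underS r \<alpha>)" by blast
      \<comment> \<open>Members of \<open>Func\<close> are \<open>undefined\<close> off their
        domain; by \<open>y_cong'\<close> truncating the labels does not change the node.\<close>
      define f where "f \<beta> = (if \<beta> \<in> underS r \<alpha> then t \<beta> else undefined)" for \<beta>
      have "y f ` underS r \<alpha> = y t ` underS r \<alpha>" by (rule y_cong') (simp add: f_def)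
      moreover have "f \<in> Func (underS r \<alpha>) T"
        using Qt by (auto simp: Func_def f_def Q_def underS_def Field_def)
      ultimately show ?thesis using \<alpha> unfolding Codes_def by fastforce
    next
      case False
      define D where "D \<alpha> = y t ` underS r \<alpha>" for \<alpha>
      define U where "U \<alpha> = g (D \<alpha>) (t \<alpha>)" for \<alpha>
      define E where "E = y t ` Field r"
      have U: "openin X (U \<alpha>)" "X closure_of D \<alpha> \<subseteq> U \<alpha>" "p \<notin> U \<alpha>" if "\<alpha> \<in> Field r" for \<alpha>
        using Qt[OF that] False that g(1)[OF yX yc[OF that], of "t \<alpha>"]
        unfolding Q_def U_def D_def by blast+
      \<comment> \<open>All \<open>U \<beta>\<close> omit \<open>p\<close>, so they never cover the
        space and \<open>h\<close> does not resort to its default.\<close>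
      have y_avoids: "y t \<alpha> \<notin> U \<beta>" if "(\<beta>, \<alpha>) \<in> r" for \<alpha> \<beta>
      proof -
        have "p \<notin> (\<Union>\<beta>\<in>under r \<alpha>. U \<beta>)" using U(3) by (auto simp: under_def Field_def)
        then have "y t \<alpha> \<notin> (\<Union>\<beta>\<in>under r \<alpha>. U \<beta>)"
          unfolding y[of t \<alpha>] U_def D_def using p by (intro h(2)) blast
        then show ?thesis using that by (auto simp: under_def)
      qed
      have EX: "E \<subseteq> topspace X" unfolding E_def by (rule yX)
      have DU: "D \<alpha> \<subseteq> U \<alpha>" if "\<alpha> \<in> Field r" for \<alpha>
        using U(2)[OF that] closure_of_subset[of "D \<alpha>" X] yX unfolding D_def by blast
      have "discrete_in X E"
      proof (rule discrete_inI[OF EX])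
        fix d assume "d \<in> E"
        then obtain \<alpha> where \<alpha>: "\<alpha> \<in> Field r" "d = y t \<alpha>" unfolding E_def by blast
        \<comment> \<open>Let \<beta> be the immediate successor of \<alpha>. Then
          \<open>U \<beta>\<close> contains \<open>d\<close> and none of the points from level
          \<beta> on, while the closure of \<open>D \<alpha>\<close> contains all points from below
          \<alpha>; their difference isolates \<open>d\<close>.\<close>
        have "{\<beta>. \<alpha> \<in> underS r \<beta>} \<noteq> {}" using nomax[OF \<alpha>(1)] by blast
        then obtain \<beta> where \<beta>: "\<beta> \<in> {\<beta>. \<alpha> \<in> underS r \<beta>}" and
            min: "\<And>\<gamma>. (\<gamma>, \<beta>) \<in> r - Id \<Longrightarrow> \<gamma> \<notin> {\<beta>. \<alpha> \<in> underS r \<beta>}"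
          using wf by (metis wfE_min')
        then have \<beta>F: "\<beta> \<in> Field r" by (auto simp: underS_def Field_def)
        let ?N = "U \<beta> - X closure_of D \<alpha>"
        have "openin X ?N" using U(1)[OF \<beta>F] by (blast intro: openin_diff closedin_closure_of)
        moreover have "d \<in> ?N"
          using DU[OF \<beta>F] \<beta> \<alpha> y_avoids[of \<alpha> \<alpha>] rfl U(2)[OF \<alpha>(1)] unfolding D_def by blast
        moreover have "e = d" if e: "e \<in> E" "e \<in> ?N" for e
        proof -
          obtain \<gamma> where \<gamma>: "\<gamma> \<in> Field r" "e = y t \<gamma>" using e(1) unfolding E_def by blast
          have "\<gamma> \<notin> underS r \<alpha>"
            using e(2) \<gamma> closure_of_subset[of "D \<alpha>" X] yX unfolding D_def by blast
          moreover have "\<alpha> \<notin> underS r \<gamma>"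
          proof
            assume "\<alpha> \<in> underS r \<gamma>"
            then have "(\<gamma>, \<beta>) \<notin> r - Id" using min by blast
            then have "(\<beta>, \<gamma>) \<in> r"
              using cmp[OF \<gamma>(1) \<beta>F] by blast
            then show False using y_avoids e(2) \<gamma>(2) by blast
          qed
          ultimately have "\<gamma> = \<alpha>"
            using cmp[OF \<alpha>(1) \<gamma>(1)] unfolding underS_def by blast
          then show ?thesis using \<alpha> \<gamma> by simp
        qed
        ultimately show "\<exists>N. openin X N \<and> N \<inter> E = {d}"
          using \<open>d \<in> E\<close> by (intro exI[of _ ?N]) blast
      qed
      then obtain Z where Z: "E \<subseteq> Z" "Z \<subseteq> topspace X" "Lindelof_space (subtopology X Z)"
        using adl unfolding almost_discretely_Lindelof_def by blast
      \<comment> \<open>This covers \<open>Z\<close>: by tightness and regularity of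
        \<open>\<kappa>\<^sup>+\<close>, a point in the closure of \<open>E\<close> is already in
        the closure of some \<open>D \<alpha>\<close>, hence in \<open>U \<alpha>\<close>.\<close>
      let ?C = "insert (topspace X - X closure_of E) (U ` Field r)"
      have "\<forall>W\<in>?C. openin X W" using U(1) by (auto intro: openin_diff)
      moreover have "Z \<subseteq> \<Union>?C"
      proof
        fix z assume z: "z \<in> Z"
        show "z \<in> \<Union>?C"
        proof (cases "z \<in> X closure_of E")
          case True
          then obtain B where B: "B \<subseteq> E" "|B| \<le>o \<kappa>" "z \<in> X closure_of B"
            using tight by blast
          then obtain I where I: "I \<subseteq> Field r" "inj_on (y t) I" "B = y t ` I"
            unfolding E_def by (meson subset_image_inj)
          have "|I| \<le>o |B|"
            unfolding I(3) by (rule card_of_ordLeqI[OF I(2)]) blast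
          then have "|I| \<le>o \<kappa>" using B(2) ordLeq_transitive by blast
          then obtain \<alpha> where \<alpha>: "\<alpha> \<in> Field r" "I \<subseteq> underS r \<alpha>" using bounded I(1) by blast
          then have "B \<subseteq> D \<alpha>" unfolding I(3) D_def by blast
          then have "z \<in> U \<alpha>" using U(2)[OF \<alpha>(1)] closure_of_mono[of B "D \<alpha>" X] B(3) by blast
          then show ?thesis using \<alpha>(1) by blast
        next
          case False
          then show ?thesis using z Z(2) by blast
        qed
      qed
      ultimately obtain \<C> where \<C>: "countable \<C>" "\<C> \<subseteq> ?C" "Z \<subseteq> \<Union>\<C>"
        using Z(3) unfolding Lindelof_space_subtopology_subset[OF Z(2)] by metis
      have "countable (\<C> \<inter> U ` Field r)" using \<C>(1) by blast
      then obtain I where I: "countable I" "I \<subseteq> Field r" "\<C> \<inter> U ` Field r = U ` I"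
        by (meson countable_subset_image inf_le2)
      \<comment> \<open>Beyond all the countably many indices used, \<open>y t \<alpha>\<close> lies
        in \<open>E\<close> but in no member of the subcover, a contradiction.\<close>
      obtain \<alpha> where \<alpha>: "\<alpha> \<in> Field r" "I \<subseteq> underS r \<alpha>"
        using bounded[OF I(2) countable_ordLeq[OF I(1) \<kappa>]] by blast
      have yE: "y t \<alpha> \<in> E" using \<alpha>(1) unfolding E_def by blast
      then obtain W where W: "W \<in> \<C>" "y t \<alpha> \<in> W" using Z(1) \<C>(3) by blast
      have "W \<noteq> topspace X - X closure_of E"
        using W(2) yE closure_of_subset[OF EX] by blast
      then have "W \<in> U ` I" using W(1) \<C>(2) I(3) by blast
      then obtain \<beta> where "\<beta> \<in> I" "W = U \<beta>" by blast
      then show ?thesis using y_avoids[of \<beta> \<alpha>] \<alpha>(2) W(2) by (auto simp: underS_def)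
    qed
  qed

  \<comment> \<open>Counting the nodes\<close>
  then have "topspace X \<subseteq> (\<Union>c\<in>Codes. X closure_of (y (snd c) ` underS r (fst c)))"
    by (fastforce simp: case_prod_beta)
  moreover have "|\<Union>c\<in>Codes. X closure_of (y (snd c) ` underS r (fst c))| \<le>o ctwo ^c \<kappa>"
  proof (rule card_of_UN_ordLeq[OF \<mu>])
    have "|Field r| \<le>o ctwo ^c \<kappa>"
    proof (rule ordLeq_transitive[OF card_of_Field_ordLeq[OF cor]])
      show "r \<le>o ctwo ^c \<kappa>"
        unfolding r_def using \<mu> by (intro cardSuc_least[OF co] ordLess_ctwo_cexp[OF co]) blast
    qed
    moreover have "|Func (underS r \<alpha>) T| \<le>o ctwo ^c \<kappa>" if "\<alpha> \<in> Field r" for \<alpha>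
      unfolding T_def using \<mu>
      by (intro card_of_Func_ordLeq[OF \<kappa> card_underS[OF that]] card_of_Field_ordLeq) blast
    ultimately show "|Codes| \<le>o ctwo ^c \<kappa>"
      unfolding Codes_def using \<mu>
      by (intro card_of_Sigma_ordLeq_infinite_Field) (auto simp: BNF_Cardinal_Arithmetic.cinfinite_def)
  next
    fix c assume "c \<in> Codes"
    then have "fst c \<in> Field r" unfolding Codes_def by auto
    then show "|X closure_of (y (snd c) ` underS r (fst c))| \<le>o ctwo ^c \<kappa>"
      by (intro cl yX yc)
  qed
  ultimately show ?thesis by (rule card_of_subset_ordLeq)
qed

section \<open>Almost discretely Lindelof spaces\<close>

lemma Lindelof_imp_almost_discretely_Lindelof:
  "Lindelof_space X \<Longrightarrow> almost_discretely_Lindelof X"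
  unfolding almost_discretely_Lindelof_def discrete_in_def
  by (metis order_refl subtopology_topspace)

text \<open>Arhangelskii's inequality for Lindelof Hausdorff spaces. For \<open>psi\<close>, a point
  outside a closure is separated from it by a union of countably many basic sets, and there are at
  most \<open>2\<^sup>\<kappa>\<close> such unions.\<close>

lemma card_Lindelof_Hausdorff:
  fixes X :: "'a topology"
  assumes V: "indexed_base X \<kappa> V" and \<kappa>: "Cinfinite \<kappa>" and H: "Hausdorff_space X"
    and L: "Lindelof_space X"
  shows "|topspace X| \<le>o ctwo ^c \<kappa>"
proof (rule card_le_of_closure_pseudocharacter[OF \<kappa>])
  have co: "Card_order \<kappa>" using \<kappa> by blast
  have \<mu>: "Cinfinite (ctwo ^c \<kappa>)" by (rule Cinfinite_ctwo_cexp[OF \<kappa>])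
  show "\<exists>B\<subseteq>A. |B| \<le>o \<kappa> \<and> p \<in> X closure_of B" if "p \<in> X closure_of A" for A p
    by (rule closure_of_tight[OF V co that]) blast
  show "almost_discretely_Lindelof X"
    by (rule Lindelof_imp_almost_discretely_Lindelof[OF L])
  show cl: "|X closure_of A| \<le>o ctwo ^c \<kappa>" if "|A| \<le>o \<kappa>" for A
    by (rule card_of_closure_of_ordLeq[OF V \<kappa> H ordLeq_ctwo_cexp[OF \<kappa> that]])
  fix A :: "'a set" assume A: "|A| \<le>o \<kappa>"
  let ?K = "X closure_of A"
  \<comment> \<open>The empty set is added so that every countable subfamily, even the empty one,
    yields a sequence in \<open>\<B>\<close> with the same union.\<close>
  define \<B> where "\<B> = insert {} (\<Union>z\<in>?K. V z ` Field \<kappa>)"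
  define \<O> where "\<O> = {U. ?K \<subseteq> U \<and> U \<in> (\<lambda>s :: nat \<Rightarrow> 'a set. \<Union>(range s)) ` Func UNIV \<B>}"
  have \<B>: "|\<B>| \<le>o ctwo ^c \<kappa>"
    unfolding \<B>_def
    by (rule card_of_insert_ordLeq[OF \<mu>], rule card_of_UN_ordLeq[OF \<mu> cl[OF A]], rule card_of_image_ordLeq)
      (rule ordLeq_ctwo_cexp[OF \<kappa> card_of_Field_ordLeq[OF co]])
  have "|Func (UNIV :: nat set) \<B>| \<le>o ctwo ^c \<kappa>"
    by (rule card_of_Func_ordLeq[OF \<kappa> countable_ordLeq[OF _ \<kappa>] \<B>]) simp
  then have "|\<O>| \<le>o ctwo ^c \<kappa>"
    unfolding \<O>_def by (rule card_of_subset_ordLeq[OF _ card_of_image_ordLeq, rotated]) blast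
  moreover have "openin X (V z i)" if "z \<in> ?K" "i \<in> Field \<kappa>" for z i
    using that V unfolding indexed_base_def in_closure_of by blast
  then have "openin X B" if "B \<in> \<B>" for B
    using that unfolding \<B>_def by auto
  then have "openin X U \<and> ?K \<subseteq> U" if "U \<in> \<O>" for U
    using that unfolding \<O>_def Func_def by (auto intro!: openin_Union)
  moreover have "\<exists>U\<in>\<O>. p \<notin> U" if p: "p \<in> topspace X - ?K" for p
  proof -
    have "\<exists>i\<in>Field \<kappa>. p \<notin> V z i" if z: "z \<in> ?K" for z
    proof -
      have zX: "z \<in> topspace X" and "z \<noteq> p" using z p by (auto simp: in_closure_of)
      then obtain S T where "openin X S" "z \<in> S" "p \<in> T" "disjnt S T"
        using H p unfolding Hausdorff_space_def by blast
      moreover then obtain i where "i \<in> Field \<kappa>" "V z i \<subseteq> S"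
        using V zX unfolding indexed_base_def by meson
      ultimately show ?thesis by (auto simp: disjnt_iff)
    qed
    then obtain i where i: "\<And>z. z \<in> ?K \<Longrightarrow> i z \<in> Field \<kappa> \<and> p \<notin> V z (i z)" by metis
    let ?C = "(\<lambda>z. V z (i z)) ` ?K"
    have C: "openin X (V z (i z)) \<and> z \<in> V z (i z)" if "z \<in> ?K" for z
      using V i[OF that] that unfolding indexed_base_def in_closure_of by blast
    have "Lindelof_space (subtopology X ?K)"
      by (rule Lindelof_space_closedin_subtopology[OF L closedin_closure_of])
    moreover have "\<forall>W\<in>?C. openin X W" "?K \<subseteq> \<Union>?C" using C by blast+
    ultimately obtain \<C> where \<C>: "countable \<C>" "\<C> \<subseteq> ?C" "?K \<subseteq> \<Union>\<C>"
      unfolding Lindelof_space_subtopology_subset[OF closure_of_subset_topspace[of X A]] by metis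
    let ?s = "from_nat_into (insert {} \<C>)"
    have s: "range ?s = insert {} \<C>" by (rule range_from_nat_into) (use \<C>(1) in auto)
    have "insert {} \<C> \<subseteq> \<B>" using \<C>(2) i unfolding \<B>_def by blast
    then have "?s \<in> Func UNIV \<B>" using s unfolding Func_def by blast
    moreover have "\<Union>(range ?s) = \<Union>\<C>" unfolding s by simp
    ultimately have "\<Union>\<C> \<in> \<O>" using \<C>(3) unfolding \<O>_def by (metis (mono_tags, lifting) image_eqI mem_Collect_eq)
    moreover have "p \<notin> \<Union>\<C>" using \<C>(2) i by blast
    ultimately show ?thesis by blast
  qed
  ultimately show "\<exists>\<O>. |\<O>| \<le>o ctwo ^c \<kappa> \<and> (\<forall>U\<in>\<O>. openin X U \<and> ?K \<subseteq> U) \<and>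
      (\<forall>p\<in>topspace X - ?K. \<exists>U\<in>\<O>. p \<notin> U)"
    by blast
qed

text \<open>A Lindelof subspace containing \<open>D\<close> inherits the Hausdorff property and the
  local bases, so Arhangelskii's inequality bounds its size.\<close>

lemma card_discrete_in:
  assumes V: "indexed_base X \<kappa> V" and \<kappa>: "Cinfinite \<kappa>" and H: "Hausdorff_space X"
    and adl: "almost_discretely_Lindelof X" and D: "discrete_in X D"
  shows "|D| \<le>o ctwo ^c \<kappa>"
proof -
  obtain Z where Z: "D \<subseteq> Z" "Z \<subseteq> topspace X" "Lindelof_space (subtopology X Z)"
    using adl D unfolding almost_discretely_Lindelof_def by blast
  have "|topspace (subtopology X Z)| \<le>o ctwo ^c \<kappa>"
    by (rule card_Lindelof_Hausdorff[OF indexed_base_subtopology[OF V] \<kappa> Hausdorff_space_subtopology[OF H] Z(3)])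
  moreover have "D \<subseteq> topspace (subtopology X Z)" using Z(1,2) by auto
  ultimately show ?thesis by (rule card_of_subset_ordLeq[rotated])
qed

text \<open>The discrete set from Shapirovskii's lemma has at most \<open>2\<^sup>\<kappa>\<close>
  points, and so has its closure; one member of \<open>\<V>\<close> for each point of this closure
  in \<open>\<Union>\<V>\<close> is enough.\<close>

lemma small_subcover:
  assumes V: "indexed_base X \<kappa> V" and \<kappa>: "Cinfinite \<kappa>" and H: "Hausdorff_space X"
    and adl: "almost_discretely_Lindelof X" and \<V>: "\<And>U. U \<in> \<V> \<Longrightarrow> openin X U"
  obtains \<W> where "\<W> \<subseteq> \<V>" "|\<W>| \<le>o ctwo ^c \<kappa>" "\<Union>\<W> = \<Union>\<V>"
proof -
  have "\<forall>x\<in>\<Union>\<V>. \<exists>U. U \<in> \<V> \<and> x \<in> U" by blast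
  then obtain W where W: "\<And>x. x \<in> \<Union>\<V> \<Longrightarrow> W x \<in> \<V> \<and> x \<in> W x" by metis
  obtain D where D: "discrete_in X D" "D \<subseteq> \<Union>\<V>" "\<Union>\<V> \<subseteq> X closure_of D \<union> (\<Union>d\<in>D. W d)"
    by (rule Shapirovskii[OF \<V> W])
  \<comment> \<open>Points of the closure are covered by their own \<open>W x\<close>, all others by
    some \<open>W d\<close> with \<open>d \<in> D\<close>, and \<open>D\<close> is part of its
    closure.\<close>
  let ?\<W> = "W ` (X closure_of D \<inter> \<Union>\<V>)"
  have cl: "D \<subseteq> X closure_of D" using D(1) by (intro closure_of_subset) (simp add: discrete_in_def)
  have sub: "?\<W> \<subseteq> \<V>" using W by blast
  have "\<exists>d\<in>X closure_of D \<inter> \<Union>\<V>. x \<in> W d" if x: "x \<in> \<Union>\<V>" for x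
  proof (cases "x \<in> X closure_of D")
    case True
    then show ?thesis using x W[OF x] by (intro bexI[of _ x]) auto
  next
    case False
    then obtain d where "d \<in> D" "x \<in> W d" using x D(3) by blast
    then show ?thesis using cl D(2) by (intro bexI[of _ d]) auto
  qed
  then have "\<Union>\<V> \<subseteq> \<Union>?\<W>" by (intro subsetI) (simp only: UN_iff)
  then have "\<Union>?\<W> = \<Union>\<V>" using Union_mono[OF sub] by (intro equalityI)
  moreover have "|?\<W>| \<le>o ctwo ^c \<kappa>"
    by (intro card_of_image_ordLeq card_of_subset_ordLeq[OF Int_lower1]
        card_of_closure_of_ordLeq[OF V \<kappa> H] card_discrete_in[OF V \<kappa> H adl D(1)])
  ultimately show ?thesis by (intro that[OF sub])
qed

theorem theorem4:
  fixes X :: "'a topology"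
  assumes "T3_space X"
    and "almost_discretely_Lindelof X"
  shows "|topspace X| \<le>o ctwo ^c character X"
proof -
  let ?\<kappa> = "character X"
  have reg: "regular_space X" and H: "Hausdorff_space X"
    using assms(1) regular_t1_imp_Hausdorff_space unfolding T3_space_def by blast+
  have \<kappa>: "Cinfinite ?\<kappa>" using char_bound_character[of X] unfolding char_bound_def by blast
  then have co: "Card_order ?\<kappa>" by blast
  obtain V where V: "indexed_base X ?\<kappa> V"
    by (rule char_bound_imp_indexed_base[OF char_bound_character])
  show ?thesis
  proof (rule card_le_of_closure_pseudocharacter[OF \<kappa> _ assms(2)])
    show "\<exists>B\<subseteq>A. |B| \<le>o ?\<kappa> \<and> p \<in> X closure_of B" if "p \<in> X closure_of A" for A p
      by (rule closure_of_tight[OF V co that]) blast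
    show "|X closure_of A| \<le>o ctwo ^c ?\<kappa>" if "|A| \<le>o ?\<kappa>" for A
      by (rule card_of_closure_of_ordLeq[OF V \<kappa> H ordLeq_ctwo_cexp[OF \<kappa> that]])
    fix A :: "'a set"
    let ?K = "X closure_of A"
    let ?\<V> = "{U. openin X U \<and> disjnt ?K (X closure_of U)}"
    obtain \<W> where \<W>: "\<W> \<subseteq> ?\<V>" "|\<W>| \<le>o ctwo ^c ?\<kappa>" "\<Union>\<W> = \<Union>?\<V>"
      by (rule small_subcover[OF V \<kappa> H assms(2), of ?\<V>]) auto
    let ?\<O> = "(\<lambda>U. topspace X - X closure_of U) ` \<W>"
    have "|?\<O>| \<le>o ctwo ^c ?\<kappa>" by (rule card_of_image_ordLeq[OF \<W>(2)])
    moreover have "openin X (topspace X - X closure_of U) \<and> ?K \<subseteq> topspace X - X closure_of U"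
      if "U \<in> \<W>" for U
      using that \<W>(1) closure_of_subset_topspace[of X A] by (auto simp: disjnt_iff)
    moreover have "\<exists>U\<in>?\<O>. p \<notin> U" if p: "p \<in> topspace X - ?K" for p
    proof -
      \<comment> \<open>Regularity in its closure form: \<open>p\<close> has an open neighbourhood
        whose closure misses \<open>?K\<close>. Hence \<open>\<W>\<close>, having the same union as
        \<open>?\<V>\<close>, still reaches every point outside \<open>?K\<close>.\<close>
      have "p \<in> \<Union>?\<V>"
        using reg p closedin_closure_of[of X A] unfolding regular_space by blast
      then obtain U where U: "U \<in> \<W>" "p \<in> U" using \<W>(3) by blast
      then have "p \<in> X closure_of U" using p unfolding in_closure_of by blast
      then show ?thesis using U(1) by blast
    qed
    ultimately show "\<exists>\<O>. |\<O>| \<le>o ctwo ^c ?\<kappa> \<and> (\<forall>U\<in>\<O>. openin X U \<and> ?K \<subseteq> U) \<and>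
        (\<forall>p\<in>topspace X - ?K. \<exists>U\<in>\<O>. p \<notin> U)"
      by (intro exI[of _ ?\<O>]) blast
  qed
qed

end
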